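(* Let $n\ge1$ and $f\in\mathcal{LC}_n$. Then the marginal $$g(t_1,\dots,t_{n-1}):=\frac{f(t_1,\dots,t_{n-1},1)}{1+f_{\{n\}}}$$ belongs to $\mathcal{LC}_{n-1}$.
   Context: $[n]=\{1,\dots,n\}$. The squarefree algebra $\mathcal{A}_n:=\mathbb{R}[t_1,\dots,t_n]/(t_1^2,\dots,t_n^2)$ has basis $\{t^S: S\subseteq[n]\}$ with $t^S:=\prod_{i\in S}t_i$, $t^\varnothing=1$; write $f=\sum_{S\subseteq[n]}f_S t^S$ with $f_S\in\mathbb{R}$, and identify $f$ with this multiaffine polynomial (so substituting $t_n=1$ means substituting in this multiaffine representative, the result being viewed in $\mathcal{A}_{n-1}$). For $f\in\mathcal{A}_n$ with $f_\varnothing=1$, define $\log f:=\sum_{k=1}^n\frac{(-1)^{k+1}}{k}(f-1)^k=\sum_{\varnothing\ne S\subseteq[n]}\kappa_S(f)\,t^S$. $\mathcal{LC}_n$ is the set of $f\in\mathcal{A}_n$ with $f_S\ge0$ for all $S\subseteq[n]$, $f_\varnothing=1$, and $\kappa_S(f)\le0$ for all $S\subseteq[n]$ with $|S|\ge2$. *)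

theory Defs
  imports Complex_Main
begin

text \<open>
  The type \<open>sqfree\<close> is the real algebra \<open>\<real>[t\<^sub>0, t\<^sub>1, t\<^sub>2, \<dots>] / (t\<^sub>i\<^sup>2)\<close>, an element being given by its
  coefficients \<open>f\<^sub>S\<close> in the basis of squarefree monomials \<open>t\<^sup>S\<close>, for \<open>S\<close> a finite set of indices.
  The algebra \<open>\<A>\<^sub>n\<close> is the subalgebra \<open>sqfree_alg n\<close> below, on the variables \<open>t\<^sub>1, \<dots>, t\<^sub>n\<close>; this way
  the algebras for different \<open>n\<close> share one multiplication.  The instance proofs together with the
  lemmas \<open>sqvar_square\<close>, \<open>coeff_sqmonom\<close> and \<open>sqfree_expansion\<close> identify the algebra: it is commutative,
  \<open>t\<^sub>i\<^sup>2 = 0\<close>, and the products \<open>t\<^sup>S\<close> of variables form a basis.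
\<close>

typedef sqfree = "{f :: nat set \<Rightarrow> real. finite {S. f S \<noteq> 0} \<and> (\<forall>S. f S \<noteq> 0 \<longrightarrow> finite S)}"
  morphisms coeff Abs_sqfree
  by (rule exI[of _ "\<lambda>_. 0"]) auto

setup_lifting type_definition_sqfree

lemma sqfree_eqI: "(\<And>S. finite S \<Longrightarrow> coeff f S = coeff g S) \<Longrightarrow> f = g"
proof (transfer, rule ext)
  fix f g :: "nat set \<Rightarrow> real" and S
  assume "finite {S. f S \<noteq> 0} \<and> (\<forall>S. f S \<noteq> 0 \<longrightarrow> finite S)"
    and "finite {S. g S \<noteq> 0} \<and> (\<forall>S. g S \<noteq> 0 \<longrightarrow> finite S)"
    and "\<And>S. finite S \<Longrightarrow> f S = g S"
  then show "f S = g S" by metis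
qed

lemma coeff_infinite: "infinite S \<Longrightarrow> coeff f S = 0"
  by transfer auto

lemma finite_coeff_support: "finite {S. coeff f S \<noteq> 0}"
  by transfer auto

instantiation sqfree :: real_algebra_1
begin

lift_definition zero_sqfree :: sqfree is "\<lambda>_. 0" by auto

lift_definition one_sqfree :: sqfree is "\<lambda>S. if S = {} then 1 else 0" by auto

lift_definition plus_sqfree :: "sqfree \<Rightarrow> sqfree \<Rightarrow> sqfree" is "\<lambda>f g S. f S + g S"
proof -
  fix f g :: "nat set \<Rightarrow> real"
  assume f: "finite {S. f S \<noteq> 0} \<and> (\<forall>S. f S \<noteq> 0 \<longrightarrow> finite S)"
    and g: "finite {S. g S \<noteq> 0} \<and> (\<forall>S. g S \<noteq> 0 \<longrightarrow> finite S)"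
  have "finite {S. f S + g S \<noteq> 0}"
    by (rule finite_subset[of _ "{S. f S \<noteq> 0} \<union> {S. g S \<noteq> 0}"]) (use f g in auto)
  moreover have "finite S" if "f S + g S \<noteq> 0" for S
    using f g that by (cases "f S = 0") auto
  ultimately show "finite {S. f S + g S \<noteq> 0} \<and> (\<forall>S. f S + g S \<noteq> 0 \<longrightarrow> finite S)"
    by blast
qed

lift_definition scaleR_sqfree :: "real \<Rightarrow> sqfree \<Rightarrow> sqfree" is "\<lambda>c f S. c * f S"
  by simp

definition uminus_sqfree :: "sqfree \<Rightarrow> sqfree" where "- f = (-1) *\<^sub>R (f :: sqfree)"

definition minus_sqfree :: "sqfree \<Rightarrow> sqfree \<Rightarrow> sqfree" where "f - g = f + - (g :: sqfree)"

text \<open>The product is determined by \<open>t\<^sup>T t\<^sup>U = t\<^bsup>T \<union> U\<^esup>\<close> for disjoint \<open>T\<close>, \<open>U\<close> and \<open>t\<^sup>T t\<^sup>U = 0\<close> otherwise.\<close>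

lift_definition times_sqfree :: "sqfree \<Rightarrow> sqfree \<Rightarrow> sqfree"
  is "\<lambda>f g S. \<Sum>T\<in>Pow S. f T * g (S - T)"
proof -
  fix f g :: "nat set \<Rightarrow> real"
  assume f: "finite {S. f S \<noteq> 0} \<and> (\<forall>S. f S \<noteq> 0 \<longrightarrow> finite S)"
    and g: "finite {S. g S \<noteq> 0} \<and> (\<forall>S. g S \<noteq> 0 \<longrightarrow> finite S)"
  have "{S. (\<Sum>T\<in>Pow S. f T * g (S - T)) \<noteq> 0}
      \<subseteq> (\<lambda>(T, U). T \<union> U) ` ({S. f S \<noteq> 0} \<times> {S. g S \<noteq> 0})"
  proof
    fix S assume "S \<in> {S. (\<Sum>T\<in>Pow S. f T * g (S - T)) \<noteq> 0}"
    then have "(\<Sum>T\<in>Pow S. f T * g (S - T)) \<noteq> 0" by simp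
    then obtain T where "T \<in> Pow S" "f T * g (S - T) \<noteq> 0" by (rule sum.not_neutral_contains_not_neutral)
    then show "S \<in> (\<lambda>(T, U). T \<union> U) ` ({S. f S \<noteq> 0} \<times> {S. g S \<noteq> 0})"
      by (intro image_eqI[of _ _ "(T, S - T)"]) auto
  qed
  moreover have "finite S" if "(\<Sum>T\<in>Pow S. f T * g (S - T)) \<noteq> 0" for S
    using that by (cases "finite S") auto
  ultimately show "finite {S. (\<Sum>T\<in>Pow S. f T * g (S - T)) \<noteq> 0} \<and>
      (\<forall>S. (\<Sum>T\<in>Pow S. f T * g (S - T)) \<noteq> 0 \<longrightarrow> finite S)"
    using f g by (meson finite_SigmaI finite_imageI finite_subset)
qed

lemma coeff_basic [simp]:
  "coeff 0 S = 0"
  "coeff 1 S = (if S = {} then 1 else 0)"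
  "coeff (f + g) S = coeff f S + coeff g S"
  "coeff (c *\<^sub>R f) S = c * coeff f S"
  "coeff (- f) S = - coeff f S"
  "coeff (f - g) S = coeff f S - coeff g S"
  by (simp_all add: uminus_sqfree_def minus_sqfree_def zero_sqfree.rep_eq one_sqfree.rep_eq
      plus_sqfree.rep_eq scaleR_sqfree.rep_eq)

lemma coeff_mult: "coeff (f * g) S = (\<Sum>T\<in>Pow S. coeff f T * coeff g (S - T))"
  by (simp add: times_sqfree.rep_eq)

lemma sqfree_mult_commute: "f * g = g * (f :: sqfree)"
proof (rule sqfree_eqI)
  fix S :: "nat set"
  show "coeff (f * g) S = coeff (g * f) S"
    unfolding coeff_mult
    by (rule sum.reindex_bij_witness[of _ "\<lambda>T. S - T" "\<lambda>T. S - T"])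
       (auto simp: double_diff)
qed

lemma sqfree_mult_assoc: "(f * g) * h = f * (g * (h :: sqfree))"
proof (rule sqfree_eqI)
  fix S :: "nat set"
  assume S: "finite S"
  have fin: "finite (Pow T)" if "T \<subseteq> S" for T using S that finite_subset by auto
  have "coeff ((f * g) * h) S
      = (\<Sum>(U, T)\<in>(SIGMA U:Pow S. Pow U). coeff f T * coeff g (U - T) * coeff h (S - U))"
    unfolding coeff_mult sum_distrib_right using fin by (subst sum.Sigma) auto
  also have "\<dots> = (\<Sum>(T, V)\<in>(SIGMA T:Pow S. Pow (S - T)).
      coeff f T * (coeff g V * coeff h (S - T - V)))"
  proof (rule sum.reindex_bij_witness[of _ "\<lambda>(T, V). (T \<union> V, T)" "\<lambda>(U, T). (T, U - T)"], goal_cases)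
    case (5 x)
    then obtain U T where x: "x = (U, T)" "T \<subseteq> U" "U \<subseteq> S" by auto
    then have "S - T - (U - T) = S - U" by blast
    with x show ?case by (simp add: mult.assoc)
  qed auto
  also have "\<dots> = coeff (f * (g * h)) S"
    unfolding coeff_mult sum_distrib_left using fin by (subst sum.Sigma) auto
  finally show "coeff ((f * g) * h) S = coeff (f * (g * h)) S" .
qed

lemma sqfree_mult_1_left: "1 * f = (f :: sqfree)"
proof (rule sqfree_eqI)
  fix S :: "nat set"
  assume S: "finite S"
  have "coeff (1 * f) S = (\<Sum>T\<in>Pow S. if T = {} then coeff f S else 0)"
    unfolding coeff_mult by (rule sum.cong) auto
  with S show "coeff (1 * f) S = coeff f S" by (simp add: sum.delta)
qed

lemma sqfree_distrib: "(f + g) * h = f * h + g * (h :: sqfree)"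
  by (rule sqfree_eqI) (simp add: coeff_mult distrib_right sum.distrib)

instance
proof
  fix a b c :: sqfree and r s :: real
  show "a * b * c = a * (b * c)" by (rule sqfree_mult_assoc)
  show "(a + b) * c = a * c + b * c" by (rule sqfree_distrib)
  show "a * (b + c) = a * b + a * c"
    by (metis sqfree_distrib sqfree_mult_commute)
  show "1 * a = a" by (rule sqfree_mult_1_left)
  show "a * 1 = a" by (metis sqfree_mult_1_left sqfree_mult_commute)
  have "coeff (0 :: sqfree) {} \<noteq> coeff 1 {}" by simp
  then show "(0 :: sqfree) \<noteq> 1" by metis
  show "r *\<^sub>R a * b = r *\<^sub>R (a * b)"
    by (rule sqfree_eqI) (simp add: coeff_mult sum_distrib_left mult.assoc)
  show "a * r *\<^sub>R b = r *\<^sub>R (a * b)"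
    by (rule sqfree_eqI) (simp add: coeff_mult sum_distrib_left mult_ac)
qed (rule sqfree_eqI, simp add: algebra_simps)+

end

instance sqfree :: comm_ring_1
proof
  fix a b c :: sqfree
  show "a * b = b * a" by (rule sqfree_mult_commute)
  show "1 * a = a" by (rule sqfree_mult_1_left)
  show "(a + b) * c = a * c + b * c" by (rule sqfree_distrib)
qed

lift_definition sqvar :: "nat \<Rightarrow> sqfree" is "\<lambda>i S. if S = {i} then 1 else 0" by auto

definition sqmonom :: "nat set \<Rightarrow> sqfree" where
  "sqmonom S = (\<Prod>i\<in>S. sqvar i)"

lemma sqvar_square: "sqvar i ^ 2 = 0"
proof (rule sqfree_eqI)
  fix S :: "nat set"
  have "coeff (sqvar i) T * coeff (sqvar i) (S - T) = 0" for T
    by (auto simp: sqvar.rep_eq)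
  then show "coeff (sqvar i ^ 2) S = coeff 0 S"
    by (simp only: power2_eq_square coeff_mult sum.neutral_const coeff_basic)
qed

lemma coeff_sqmonom: "finite S \<Longrightarrow> coeff (sqmonom S) T = (if T = S then 1 else 0)"
proof (induction S arbitrary: T rule: finite_induct)
  case empty
  then show ?case by (simp add: sqmonom_def)
next
  case (insert i S)
  have rec: "sqmonom (insert i S) = sqvar i * sqmonom S"
    using insert by (simp add: sqmonom_def)
  show ?case
  proof (cases "finite T")
    case True
    have "coeff (sqmonom (insert i S)) T
        = (\<Sum>U\<in>Pow T. if U = {i} then (if T - {i} = S then 1 else 0) else 0)"
      unfolding rec coeff_mult by (rule sum.cong) (auto simp: sqvar.rep_eq insert.IH)
    also have "\<dots> = (if T = insert i S then 1 else 0)"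
      using True insert.hyps by (auto simp: sum.delta)
    finally show ?thesis .
  next
    case False
    then show ?thesis using insert.hyps by (auto simp: coeff_infinite)
  qed
qed

lemma coeff_sum: "coeff (sum f A) S = (\<Sum>x\<in>A. coeff (f x) S)"
  by (induction A rule: infinite_finite_induct) auto

lemma sqfree_expansion: "f = (\<Sum>S | coeff f S \<noteq> 0. coeff f S *\<^sub>R sqmonom S)"
proof (rule sqfree_eqI)
  fix T :: "nat set"
  have "coeff f S * coeff (sqmonom S) T = (if T = S then coeff f S else 0)" for S
    by (cases "finite S") (simp_all add: coeff_sqmonom coeff_infinite)
  then show "coeff f T = coeff (\<Sum>S | coeff f S \<noteq> 0. coeff f S *\<^sub>R sqmonom S) T"
    by (simp add: coeff_sum sum.delta finite_coeff_support)
qed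

definition sqfree_alg :: "nat \<Rightarrow> sqfree set" where
  "sqfree_alg n = {f. \<forall>S. coeff f S \<noteq> 0 \<longrightarrow> S \<subseteq> {1..n}}"

definition sqlog :: "nat \<Rightarrow> sqfree \<Rightarrow> sqfree" where
  "sqlog n f = (\<Sum>k=1..n. ((-1) ^ (k + 1) / real k) *\<^sub>R (f - 1) ^ k)"

definition cumulant :: "nat \<Rightarrow> sqfree \<Rightarrow> nat set \<Rightarrow> real" where
  "cumulant n f S = coeff (sqlog n f) S"

definition LC :: "nat \<Rightarrow> sqfree set" where
  "LC n = {f \<in> sqfree_alg n.
     (\<forall>S\<subseteq>{1..n}. coeff f S \<ge> 0) \<and> coeff f {} = 1 \<and>
     (\<forall>S\<subseteq>{1..n}. card S \<ge> 2 \<longrightarrow> cumulant n f S \<le> 0)}"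

text \<open>
  \<open>f(t\<^sub>1, \<dots>, t\<^bsub>n-1\<^esub>, 1)\<close>, for \<open>f\<close> in \<open>sqfree_alg n\<close>: substitution of \<open>t\<^sub>n = 1\<close> in the multiaffine
  representative of \<open>f\<close>.  It is not an algebra homomorphism, since \<open>t\<^sub>n\<^sup>2 = 0\<close>.
\<close>

definition subst_last_one :: "nat \<Rightarrow> sqfree \<Rightarrow> sqfree" where
  "subst_last_one n f =
     (\<Sum>S\<in>Pow {1..n}. coeff f S *\<^sub>R (\<Prod>i\<in>S. if i = n then 1 else sqvar i))"

definition marginal :: "nat \<Rightarrow> sqfree \<Rightarrow> sqfree" where
  "marginal n f = (1 / (1 + coeff f {n})) *\<^sub>R subst_last_one n f"

end

theory Submission
  imports Defs
begin

text \<open>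
  Write \<open>f = A + t\<^sub>n B\<close> with \<open>A\<close>, \<open>B\<close> free of \<open>t\<^sub>n\<close>, and \<open>b = f\<^bsub>{n}\<^esub>\<close>.  Then \<open>log f = log A + t\<^sub>n K\<close> with
  \<open>K = B / A\<close>, so the hypothesis on the cumulants of \<open>f\<close> says that those of \<open>A\<close> are nonpositive in
  degree at least 2, and that \<open>K = b - N\<close> with \<open>N\<close> nonnegative and without constant term.
  The marginal is \<open>(A + B) / (1 + b) = A (1 - M)\<close> with \<open>M = N / (1 + b)\<close>, and
  \<open>log (A (1 - M)) = log A - (M + M\<^sup>2 / 2 + M\<^sup>3 / 3 + \<dots>)\<close>.

  The logarithm is handled through the Euler derivations \<open>t\<^sub>i \<partial>/\<partial>t\<^sub>i\<close>: the partial derivatives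
  themselves are not derivations of the algebra, because \<open>t\<^sub>i\<^sup>2 = 0\<close>.
\<close>

section \<open>Signs and lowest degrees of products and powers\<close>

lemma coeff_mult_nonneg:
  assumes "\<And>S. coeff f S \<ge> 0" and "\<And>S. coeff g S \<ge> 0"
  shows "coeff (f * g) S \<ge> 0"
  unfolding coeff_mult by (intro sum_nonneg mult_nonneg_nonneg assms)

lemma coeff_power_nonneg:
  assumes "\<And>S. coeff f S \<ge> 0"
  shows "coeff (f ^ k) S \<ge> 0"
proof (induction k arbitrary: S)
  case (Suc k)
  then show ?case by (auto intro: coeff_mult_nonneg assms)
qed simp

lemma coeff_mult_empty: "coeff (f * g) {} = coeff f {} * coeff g {}"
  by (simp add: coeff_mult)

lemma coeff_power_empty: "coeff (f ^ k) {} = coeff f {} ^ k"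
  by (induction k) (simp_all add: coeff_mult_empty)

text \<open>Lowest degrees add: if \<open>S\<close> splits into \<open>T\<close> and
  \<open>S - T\<close>, one of the two is too small for its factor.\<close>

lemma coeff_mult_eq_0_of_card:
  assumes "\<And>S. card S < j \<Longrightarrow> coeff f S = 0" and "\<And>S. card S < k \<Longrightarrow> coeff g S = 0"
    and "card S < j + k"
  shows "coeff (f * g) S = 0"
proof (cases "finite S")
  case True
  have "coeff f T * coeff g (S - T) = 0" if "T \<subseteq> S" for T
  proof -
    have "card T + card (S - T) = card S"
      using True that by (metis card_Diff_subset card_mono finite_subset le_add_diff_inverse)
    with assms(3) have "card T < j \<or> card (S - T) < k" by linarith
    then show ?thesis using assms(1,2) by auto
  qed
  then show ?thesis unfolding coeff_mult by (intro sum.neutral) auto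
qed (rule coeff_infinite)

lemma coeff_power_eq_0_of_card:
  assumes "coeff f {} = 0" and "card S < k"
  shows "coeff (f ^ k) S = 0"
  using assms(2)
proof (induction k arbitrary: S)
  case (Suc k)
  \<comment> \<open>Since \<open>card\<close> is 0 on infinite sets, this covers those as well as
    the empty set.\<close>
  have "coeff f T = 0" if "card T < 1" for T
    using that assms(1) coeff_infinite[of T f] by (cases "finite T") auto
  with Suc show ?case using coeff_mult_eq_0_of_card[of 1 f k "f ^ k" S] by simp
qed simp

section \<open>The subalgebra \<open>sqfree_alg n\<close> and cancellation in the ambient
  algebra\<close>

lemma sqfree_alg_mult:
  assumes "f \<in> sqfree_alg n" and "g \<in> sqfree_alg n"
  shows "f * g \<in> sqfree_alg n"
  unfolding sqfree_alg_def
proof (intro CollectI allI impI)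
  fix S assume "coeff (f * g) S \<noteq> 0"
  then obtain T where "T \<in> Pow S" "coeff f T * coeff g (S - T) \<noteq> 0"
    unfolding coeff_mult by (rule sum.not_neutral_contains_not_neutral)
  moreover from this have "T \<subseteq> {1..n}" "S - T \<subseteq> {1..n}"
    using assms by (auto simp: sqfree_alg_def)
  ultimately show "S \<subseteq> {1..n}" by blast
qed

lemma sqfree_alg_one: "1 \<in> sqfree_alg n"
  by (auto simp: sqfree_alg_def)

lemma sqfree_alg_sum:
  assumes "\<And>x. x \<in> A \<Longrightarrow> f x \<in> sqfree_alg n"
  shows "sum f A \<in> sqfree_alg n"
  unfolding sqfree_alg_def
proof (intro CollectI allI impI)
  fix S assume "coeff (sum f A) S \<noteq> 0"
  then obtain x where "x \<in> A" "coeff (f x) S \<noteq> 0"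
    unfolding coeff_sum by (rule sum.not_neutral_contains_not_neutral)
  with assms show "S \<subseteq> {1..n}" by (auto simp: sqfree_alg_def)
qed

lemma sqfree_alg_diff: "f \<in> sqfree_alg n \<Longrightarrow> g \<in> sqfree_alg n \<Longrightarrow> f - g \<in> sqfree_alg n"
  unfolding sqfree_alg_def by (simp, metis diff_zero)

lemma sqfree_alg_scaleR: "f \<in> sqfree_alg n \<Longrightarrow> c *\<^sub>R f \<in> sqfree_alg n"
  by (auto simp: sqfree_alg_def)

lemma sqfree_alg_power: "f \<in> sqfree_alg n \<Longrightarrow> f ^ k \<in> sqfree_alg n"
  by (induction k) (auto intro: sqfree_alg_one sqfree_alg_mult)

lemma sqfree_alg_mono: "m \<le> n \<Longrightarrow> f \<in> sqfree_alg m \<Longrightarrow> f \<in> sqfree_alg n"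
  unfolding sqfree_alg_def by fastforce

text \<open>No squarefree monomial in \<open>n\<close> variables has degree above \<open>n\<close>.
  This is what makes truncated power series exact.\<close>

lemma sqfree_alg_eq_0:
  assumes "f \<in> sqfree_alg n" and "\<And>S. card S < Suc n \<Longrightarrow> coeff f S = 0"
  shows "f = 0"
proof (rule sqfree_eqI)
  fix S :: "nat set"
  show "coeff f S = coeff 0 S"
  proof (cases "S \<subseteq> {1..n}")
    case True
    then have "card S \<le> n" using card_mono[of "{1..n}" S] by simp
    then show ?thesis using assms(2) by simp
  next
    case False
    then show ?thesis using assms(1) by (auto simp: sqfree_alg_def)
  qed
qed

text \<open>The coefficient of a product \<open>f * u\<close> at \<open>S\<close> is
  \<open>coeff f {} * coeff u S\<close> plus terms using \<open>u\<close> only on proper subsets of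
  \<open>S\<close>, so \<open>u\<close> can be recovered by induction on \<open>S\<close>.\<close>

lemma sqfree_mult_cancel:
  assumes "coeff f {} \<noteq> 0" and "f * g = f * h"
  shows "g = h"
proof (rule sqfree_eqI)
  fix S :: "nat set"
  assume "finite S"
  then show "coeff g S = coeff h S"
  proof (induction S rule: finite_psubset_induct)
    case (psubset S)
    have split: "coeff (f * u) S
        = coeff f {} * coeff u S + (\<Sum>T\<in>Pow S - {{}}. coeff f T * coeff u (S - T))" for u
      unfolding coeff_mult using psubset.hyps by (subst sum.remove[of _ "{}"]) auto
    have "(\<Sum>T\<in>Pow S - {{}}. coeff f T * coeff g (S - T))
        = (\<Sum>T\<in>Pow S - {{}}. coeff f T * coeff h (S - T))"
    proof (rule sum.cong)
      fix T assume "T \<in> Pow S - {{}}"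
      then have "S - T \<subset> S" by auto
      then show "coeff f T * coeff g (S - T) = coeff f T * coeff h (S - T)"
        by (simp add: psubset.IH)
    qed simp
    then show ?case using split[of g] split[of h] assms by simp
  qed
qed

section \<open>Euler derivations\<close>

lift_definition euler :: "nat \<Rightarrow> sqfree \<Rightarrow> sqfree" is "\<lambda>i f S. if i \<in> S then f S else 0"
  by (auto elim: rev_finite_subset)

lemma coeff_euler: "coeff (euler i f) S = (if i \<in> S then coeff f S else 0)"
  by (simp add: euler.rep_eq)

lemma euler_one [simp]: "euler i 1 = 0"
  by (rule sqfree_eqI) (auto simp: coeff_euler)

lemma euler_add: "euler i (f + g) = euler i f + euler i g"
  by (rule sqfree_eqI) (simp add: coeff_euler)

lemma euler_scaleR: "euler i (c *\<^sub>R f) = c *\<^sub>R euler i f"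
  by (rule sqfree_eqI) (simp add: coeff_euler)

lemma euler_sum: "euler i (sum f A) = (\<Sum>x\<in>A. euler i (f x))"
  by (rule sqfree_eqI) (simp add: coeff_euler coeff_sum)

lemma euler_mult: "euler i (f * g) = euler i f * g + f * euler i g"
proof (rule sqfree_eqI)
  fix S :: "nat set"
  have "(if i \<in> S then coeff f T * coeff g (S - T) else 0)
      = coeff (euler i f) T * coeff g (S - T) + coeff f T * coeff (euler i g) (S - T)"
    if "T \<in> Pow S" for T
    using that by (auto simp: coeff_euler)
  then have "(\<Sum>T\<in>Pow S. if i \<in> S then coeff f T * coeff g (S - T) else 0)
      = (\<Sum>T\<in>Pow S. coeff (euler i f) T * coeff g (S - T) + coeff f T * coeff (euler i g) (S - T))"
    by (rule sum.cong[OF refl])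
  moreover have "coeff (euler i (f * g)) S
      = (\<Sum>T\<in>Pow S. if i \<in> S then coeff f T * coeff g (S - T) else 0)"
    by (simp add: coeff_euler coeff_mult)
  ultimately show "coeff (euler i (f * g)) S = coeff (euler i f * g + f * euler i g) S"
    by (simp add: coeff_mult sum.distrib)
qed

lemma euler_power: "euler i (f ^ Suc k) = real (Suc k) *\<^sub>R (f ^ k * euler i f)"
proof (induction k)
  case (Suc k)
  have "euler i (f ^ Suc (Suc k)) = euler i f * f ^ Suc k + f * euler i (f ^ Suc k)"
    by (simp only: power_Suc[of f "Suc k"] euler_mult)
  also have "\<dots> = 1 *\<^sub>R (f ^ Suc k * euler i f) + real (Suc k) *\<^sub>R (f ^ Suc k * euler i f)"
    unfolding Suc.IH by (simp add: mult_ac)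
  also have "\<dots> = real (Suc (Suc k)) *\<^sub>R (f ^ Suc k * euler i f)"
    by (simp only: of_nat_Suc[of "Suc k"] scaleR_left_distrib)
  finally show ?case .
qed simp

lemma sqfree_alg_euler: "f \<in> sqfree_alg n \<Longrightarrow> euler i f \<in> sqfree_alg n"
  by (auto simp: sqfree_alg_def coeff_euler)

text \<open>Only constants are killed by all Euler derivations: a nonempty \<open>S\<close> contains
  some \<open>i\<close>, and \<open>euler i\<close> keeps the coefficient at
  \<open>S\<close>.\<close>

lemma sqfree_eqI_euler:
  assumes "coeff f {} = coeff g {}" and "\<And>i. euler i f = euler i g"
  shows "f = g"
proof (rule sqfree_eqI)
  fix S :: "nat set"
  show "coeff f S = coeff g S"
  proof (cases "S = {}")
    case False
    then obtain i where "i \<in> S" by blast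
    then show ?thesis using coeff_euler[of i f S] coeff_euler[of i g S] assms(2)[of i] by simp
  qed (simp add: assms(1))
qed

section \<open>The logarithm through its differential equation\<close>

lemma coeff_sqlog_empty:
  assumes "coeff f {} = 1"
  shows "coeff (sqlog n f) {} = 0"
  unfolding sqlog_def coeff_sum using assms
  by (intro sum.neutral) (simp add: coeff_power_empty)

text \<open>With \<open>x = f - 1\<close>, differentiating the truncated series gives a finite
  geometric sum in \<open>- x\<close> times \<open>euler i x\<close>. Multiplication by
  \<open>1 + x\<close> telescopes it.\<close>

lemma mult_euler_sqlog:
  assumes f: "f \<in> sqfree_alg n" and f0: "coeff f {} = 1"
  shows "f * euler i (sqlog n f) = euler i f"
proof -
  define x where "x = f - 1"
  have x: "x \<in> sqfree_alg n" and x0: "coeff x {} = 0" and f_eq: "f = 1 + x"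
    using f f0 by (simp_all add: x_def sqfree_alg_diff sqfree_alg_one)
  have ex: "euler i f = euler i x" by (simp add: f_eq euler_add)
  have "euler i (sqlog n f) = (\<Sum>k=1..n. ((-1) ^ (k + 1) / real k) *\<^sub>R euler i (x ^ k))"
    by (simp only: sqlog_def x_def euler_sum euler_scaleR)
  also have "\<dots> = (\<Sum>k<n. ((-1) ^ (Suc k + 1) / real (Suc k)) *\<^sub>R euler i (x ^ Suc k))"
    unfolding One_nat_def by (rule sum.atLeast1_atMost_eq)
  also have "\<dots> = (\<Sum>k<n. (- x) ^ k * euler i x)"
    unfolding euler_power
  proof (rule sum.cong)
    fix k assume "k \<in> {..<n}"
    have "(- x) ^ k = (-1) ^ k *\<^sub>R x ^ k"
      by (cases "even k") simp_all
    then show "((-1) ^ (Suc k + 1) / real (Suc k)) *\<^sub>R (real (Suc k) *\<^sub>R (x ^ k * euler i x))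
        = (- x) ^ k * euler i x"
      by simp
  qed simp
  also have "\<dots> = (\<Sum>k<n. (- x) ^ k) * euler i x"
    by (simp add: sum_distrib_right)
  finally have "f * euler i (sqlog n f) = ((1 - (- x)) * (\<Sum>k<n. (- x) ^ k)) * euler i x"
    by (simp add: f_eq mult.assoc)
  also have "\<dots> = (1 - (- x) ^ n) * euler i x"
    by (simp only: one_diff_power_eq)
  \<comment> \<open>The truncation error: \<open>(- x) ^ n\<close> starts in degree \<open>n\<close>
    and \<open>euler i x\<close> in degree 1, so the product starts in degree
    \<open>n + 1\<close>.\<close>
  also have "(- x) ^ n * euler i x = 0"
  proof (rule sqfree_alg_eq_0)
    show "(- x) ^ n * euler i x \<in> sqfree_alg n"
      using x sqfree_alg_scaleR[OF x, of "-1"]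
      by (auto intro!: sqfree_alg_mult sqfree_alg_power sqfree_alg_euler)
    have "coeff (euler i x) S = 0" if "card S < 1" for S
      using that coeff_infinite[of S] by (cases "finite S") (auto simp: coeff_euler)
    moreover have "coeff ((- x) ^ n) S = 0" if "card S < n" for S
      using that x0 by (intro coeff_power_eq_0_of_card) simp_all
    ultimately show "coeff ((- x) ^ n * euler i x) S = 0" if "card S < Suc n" for S
      using coeff_mult_eq_0_of_card[of n "(- x) ^ n" 1 "euler i x" S] that by simp
  qed
  then have "(1 - (- x) ^ n) * euler i x = euler i f"
    by (simp add: ex left_diff_distrib)
  finally show ?thesis .
qed

text \<open>The equations determine each \<open>euler i l\<close> because \<open>f\<close> can be
  cancelled. Identities for \<open>sqlog\<close> below are proved by checking these equations
  instead of expanding series.\<close>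

lemma sqlog_unique:
  assumes "f \<in> sqfree_alg n" and "coeff f {} = 1"
    and "coeff l {} = 0" and "\<And>i. f * euler i l = euler i f"
  shows "sqlog n f = l"
proof (rule sqfree_eqI_euler)
  show "coeff (sqlog n f) {} = coeff l {}"
    using assms by (simp add: coeff_sqlog_empty)
  show "euler i (sqlog n f) = euler i l" for i
    by (rule sqfree_mult_cancel[of f]) (use assms in \<open>simp_all add: mult_euler_sqlog\<close>)
qed

lemma sqlog_mult:
  assumes f: "f \<in> sqfree_alg n" "coeff f {} = 1" and g: "g \<in> sqfree_alg n" "coeff g {} = 1"
  shows "sqlog n (f * g) = sqlog n f + sqlog n g"
proof (rule sqlog_unique)
  show "f * g * euler i (sqlog n f + sqlog n g) = euler i (f * g)" for i
  proof -
    have "f * g * euler i (sqlog n f + sqlog n g)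
        = (f * euler i (sqlog n f)) * g + f * (g * euler i (sqlog n g))"
      by (simp add: euler_add algebra_simps)
    then show ?thesis by (simp add: mult_euler_sqlog f g euler_mult)
  qed
qed (use assms in \<open>simp_all add: sqfree_alg_mult coeff_mult_empty coeff_sqlog_empty\<close>)

text \<open>The truncation order is immaterial because the differential equation does not mention
  it. This links the logarithms taken for \<open>n - 1\<close> and for \<open>n\<close>
  variables.\<close>

lemma sqlog_mono:
  assumes "m \<le> n" and "f \<in> sqfree_alg m" and "coeff f {} = 1"
  shows "sqlog m f = sqlog n f"
  by (rule sqlog_unique)
     (use assms in \<open>simp_all add: coeff_sqlog_empty mult_euler_sqlog sqfree_alg_mono\<close>)

text \<open>The signs in the series for log(1 - g) cancel, leaving minus the sum of the
  \<open>g ^ k / k\<close>.\<close>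

lemma coeff_sqlog_one_minus_nonpos:
  assumes "\<And>S. coeff g S \<ge> 0"
  shows "coeff (sqlog n (1 - g)) S \<le> 0"
  unfolding sqlog_def coeff_sum
proof (rule sum_nonpos)
  fix k assume "k \<in> {1..n}"
  have "(- g) ^ k = (-1) ^ k *\<^sub>R g ^ k"
    by (cases "even k") simp_all
  then have "((-1) ^ (k + 1) / real k) *\<^sub>R (1 - g - 1) ^ k = - ((1 / real k) *\<^sub>R g ^ k)"
    by (simp add: power_add[symmetric] flip: mult_2)
  then show "coeff (((-1) ^ (k + 1) / real k) *\<^sub>R (1 - g - 1) ^ k) S \<le> 0"
    using coeff_power_nonneg[of g k S] assms by simp
qed

section \<open>Splitting off one variable\<close>

lift_definition drop_var :: "nat \<Rightarrow> sqfree \<Rightarrow> sqfree" is "\<lambda>i f S. if i \<in> S then 0 else f S"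
  by (auto elim: rev_finite_subset)

text \<open>The true partial derivative, that is, the factor B in f = A + t_i B, where A is
  \<open>drop_var i f\<close>.\<close>

lift_definition diff_var :: "nat \<Rightarrow> sqfree \<Rightarrow> sqfree" is "\<lambda>i f S. if i \<in> S then 0 else f (insert i S)"
proof -
  fix i and f :: "nat set \<Rightarrow> real"
  assume f: "finite {S. f S \<noteq> 0} \<and> (\<forall>S. f S \<noteq> 0 \<longrightarrow> finite S)"
  have "{S. (if i \<in> S then 0 else f (insert i S)) \<noteq> 0} \<subseteq> (\<lambda>S. S - {i}) ` {S. f S \<noteq> 0}"
  proof
    fix S assume "S \<in> {S. (if i \<in> S then 0 else f (insert i S)) \<noteq> 0}"
    then have "f (insert i S) \<noteq> 0" "S = insert i S - {i}" by (auto split: if_splits)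
    then show "S \<in> (\<lambda>S. S - {i}) ` {S. f S \<noteq> 0}" by blast
  qed
  with f show "finite {S. (if i \<in> S then 0 else f (insert i S)) \<noteq> 0} \<and>
      (\<forall>S. (if i \<in> S then 0 else f (insert i S)) \<noteq> 0 \<longrightarrow> finite S)"
    by (metis (no_types, lifting) finite_imageI finite_insert finite_subset)
qed

lemma coeff_drop_var: "coeff (drop_var i f) S = (if i \<in> S then 0 else coeff f S)"
  by (simp add: drop_var.rep_eq)

lemma coeff_diff_var: "coeff (diff_var i f) S = (if i \<in> S then 0 else coeff f (insert i S))"
  by (simp add: diff_var.rep_eq)

lemma drop_var_mult: "drop_var i (f * g) = drop_var i f * drop_var i g"
proof (rule sqfree_eqI)
  fix S :: "nat set"
  show "coeff (drop_var i (f * g)) S = coeff (drop_var i f * drop_var i g) S"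
  proof (cases "i \<in> S")
    case True
    then have "coeff (drop_var i f) T * coeff (drop_var i g) (S - T) = 0" for T
      by (auto simp: coeff_drop_var)
    then have "coeff (drop_var i f * drop_var i g) S = 0"
      by (simp only: coeff_mult sum.neutral_const)
    then show ?thesis using True by (simp add: coeff_drop_var)
  next
    case False
    then show ?thesis
      by (auto simp: coeff_drop_var coeff_mult intro!: sum.cong)
  qed
qed

lemma drop_var_euler: "drop_var i (euler j f) = euler j (drop_var i f)"
  by (rule sqfree_eqI) (simp add: coeff_drop_var coeff_euler)

lemma sqfree_alg_drop_var: "f \<in> sqfree_alg n \<Longrightarrow> drop_var i f \<in> sqfree_alg n"
  by (auto simp: sqfree_alg_def coeff_drop_var)

lemma atLeastAtMost_Diff_last: "{1..n} - {n} = {1..n - 1 :: nat}"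
  by auto

lemma sqfree_alg_drop_var_last: "f \<in> sqfree_alg n \<Longrightarrow> drop_var n f \<in> sqfree_alg (n - 1)"
  unfolding sqfree_alg_def atLeastAtMost_Diff_last[symmetric] by (auto simp: coeff_drop_var)

lemma sqfree_alg_diff_var_last: "f \<in> sqfree_alg n \<Longrightarrow> diff_var n f \<in> sqfree_alg (n - 1)"
  unfolding sqfree_alg_def atLeastAtMost_Diff_last[symmetric] by (auto simp: coeff_diff_var)

text \<open>Setting t_i = 0 is an algebra homomorphism commuting with every \<open>euler j\<close>,
  so it carries the differential equation of \<open>f\<close> to that of
  \<open>drop_var i f\<close>.\<close>

lemma sqlog_drop_var:
  assumes "f \<in> sqfree_alg n" and "coeff f {} = 1"
  shows "sqlog n (drop_var i f) = drop_var i (sqlog n f)"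
proof (rule sqlog_unique)
  show "drop_var i f * euler j (drop_var i (sqlog n f)) = euler j (drop_var i f)" for j
    using assms by (simp add: mult_euler_sqlog flip: drop_var_euler drop_var_mult)
qed (use assms in \<open>simp_all add: sqfree_alg_drop_var coeff_drop_var coeff_sqlog_empty\<close>)

text \<open>Compare the parts of \<open>f \<sqdot> t\<^sub>i \<partial>\<^sub>i log f = t\<^sub>i \<partial>\<^sub>i f\<close> that are linear in \<open>t\<^sub>i\<close>.\<close>

lemma drop_var_mult_diff_var_sqlog:
  assumes "f \<in> sqfree_alg n" and "coeff f {} = 1"
  shows "drop_var i f * diff_var i (sqlog n f) = diff_var i f"
proof (rule sqfree_eqI)
  fix S :: "nat set"
  assume S: "finite S"
  define l where "l = sqlog n f"
  show "coeff (drop_var i f * diff_var i l) S = coeff (diff_var i f) S"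
  proof (cases "i \<in> S")
    case True
    then have "coeff (drop_var i f) T * coeff (diff_var i l) (S - T) = 0" for T
      by (auto simp: coeff_drop_var coeff_diff_var)
    then have "coeff (drop_var i f * diff_var i l) S = 0"
      by (simp only: coeff_mult sum.neutral_const)
    then show ?thesis using True by (simp add: coeff_diff_var)
  next
    case False
    have "coeff (diff_var i f) S = coeff (f * euler i l) (insert i S)"
      using False assms by (simp add: coeff_diff_var l_def mult_euler_sqlog coeff_euler)
    \<comment> \<open>If \<open>T\<close> contains \<open>i\<close>, then
      \<open>insert i S - T\<close> does not, and the Euler factor vanishes.\<close>
    also have "\<dots> = (\<Sum>T\<in>Pow S. coeff f T * coeff (euler i l) (insert i S - T))"
      unfolding coeff_mult using S False
      by (intro sum.mono_neutral_right) (auto simp: coeff_euler)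
    also have "\<dots> = (\<Sum>T\<in>Pow S. coeff (drop_var i f) T * coeff (diff_var i l) (S - T))"
    proof (rule sum.cong)
      fix T assume "T \<in> Pow S"
      moreover from this False have "insert i S - T = insert i (S - T)" by blast
      ultimately show "coeff f T * coeff (euler i l) (insert i S - T)
          = coeff (drop_var i f) T * coeff (diff_var i l) (S - T)"
        using False by (auto simp: coeff_euler coeff_drop_var coeff_diff_var)
    qed simp
    finally show ?thesis by (simp add: coeff_mult)
  qed
qed

section \<open>The marginal and its logarithm\<close>

lemma sqfree_alg_sqlog: "f \<in> sqfree_alg n \<Longrightarrow> sqlog n f \<in> sqfree_alg n"
  unfolding sqlog_def
  by (intro sqfree_alg_sum sqfree_alg_scaleR sqfree_alg_power sqfree_alg_diff sqfree_alg_one)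

lemma subst_last_one_eq:
  assumes n: "n \<ge> 1" and f: "f \<in> sqfree_alg n"
  shows "subst_last_one n f = drop_var n f + diff_var n f"
proof (rule sqfree_eqI)
  fix T :: "nat set"
  have prod: "(\<Prod>i\<in>S. if i = n then 1 else sqvar i) = sqmonom (S - {n})" if "finite S" for S
    unfolding sqmonom_def using that by (intro prod.mono_neutral_cong_right) auto
  have "coeff (subst_last_one n f) T
      = (\<Sum>S\<in>Pow {1..n}. if T = S - {n} then coeff f S else 0)"
    unfolding subst_last_one_def coeff_sum
    by (intro sum.cong) (auto simp: prod coeff_sqmonom finite_subset)
  \<comment> \<open>Only \<open>T\<close> and \<open>insert n T\<close> can become \<open>T\<close>
    on removal of \<open>n\<close>; if either lies outside \<open>{1..n}\<close>, its coefficient in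
    \<open>f\<close> is 0.\<close>
  also have "\<dots> = (\<Sum>S\<in>{T, insert n T}. if T = S - {n} then coeff f S else 0)"
    by (rule sum.mono_neutral_cong) (use f in \<open>auto simp: sqfree_alg_def\<close>)
  also have "\<dots> = coeff (drop_var n f + diff_var n f) T"
  proof (cases "n \<in> T")
    case True
    then have "{T, insert n T} = {T}" and "T \<noteq> T - {n}" by auto
    with True show ?thesis by (simp add: coeff_drop_var coeff_diff_var)
  next
    case False
    then have "T \<noteq> insert n T" and "T - {n} = T" and "insert n T - {n} = T" by auto
    with False show ?thesis by (simp add: coeff_drop_var coeff_diff_var)
  qed
  finally show "coeff (subst_last_one n f) T = coeff (drop_var n f + diff_var n f) T" .
qed

theorem proposition5p5:
  fixes n :: nat and f :: sqfree
  assumes "n \<ge> 1" and "f \<in> LC n"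
  shows "marginal n f \<in> LC (n - 1)"
proof -
  define b where "b = coeff f {n}"
  define l where "l = sqlog n f"
  define A where "A = drop_var n f"
  define K where "K = diff_var n l"
  \<comment> \<open>This is N / (1 + b) with N = b - K, written so that 1 - M is visibly (1 + K) /
    (1 + b).\<close>
  define M where "M = 1 - (1 / (1 + b)) *\<^sub>R (1 + K)"
  have f: "f \<in> sqfree_alg n" and f0: "coeff f {} = 1"
    and f_nonneg: "\<And>S. S \<subseteq> {1..n} \<Longrightarrow> coeff f S \<ge> 0"
    and l_nonpos: "\<And>S. S \<subseteq> {1..n} \<Longrightarrow> card S \<ge> 2 \<Longrightarrow> coeff l S \<le> 0"
    using assms(2) by (auto simp: LC_def cumulant_def l_def)
  have l: "l \<in> sqfree_alg n" unfolding l_def by (rule sqfree_alg_sqlog[OF f])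
  have b: "b \<ge> 0" unfolding b_def using assms(1) by (intro f_nonneg) auto
  have A: "A \<in> sqfree_alg (n - 1)" and A0: "coeff A {} = 1"
    using sqfree_alg_drop_var_last[OF f] f0 by (simp_all add: A_def coeff_drop_var)
  have AK: "A * K = diff_var n f"
    unfolding A_def K_def l_def by (rule drop_var_mult_diff_var_sqlog[OF f f0])
  have K0: "coeff K {} = b"
    using arg_cong[OF AK, of "\<lambda>u. coeff u {}"] A0
    by (simp add: coeff_mult_empty coeff_diff_var b_def)
  \<comment> \<open>For \<open>n\<close> outside \<open>S\<close>, this coefficient is the cumulant
    of \<open>f\<close> at \<open>insert n S\<close>, a set of size at least 2 exactly because
    \<open>S\<close> is nonempty.\<close>
  have K_nonpos: "coeff K S \<le> 0" if "S \<noteq> {}" for S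
  proof (cases "n \<notin> S \<and> insert n S \<subseteq> {1..n}")
    case True
    then have "finite S" by (meson finite_atLeastAtMost finite_subset insert_subset)
    with True that have "card (insert n S) \<ge> 2"
      by (simp add: Suc_le_eq card_gt_0_iff numeral_2_eq_2)
    with True show ?thesis using l_nonpos by (simp add: K_def coeff_diff_var)
  next
    case False
    moreover have "coeff l (insert n S) = 0" if "\<not> insert n S \<subseteq> {1..n}"
      using l that unfolding sqfree_alg_def by blast
    ultimately have "n \<in> S \<or> coeff l (insert n S) = 0" by blast
    then show ?thesis by (auto simp: K_def coeff_diff_var)
  qed
  \<comment> \<open>The constant term is 1 - (1 + b) / (1 + b) = 0; every other coefficient is that
    of -K / (1 + b).\<close>
  have "coeff M S \<ge> 0" for S
  proof (cases "S = {}")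
    case True
    then show ?thesis using b K0 by (simp add: M_def)
  next
    case False
    then show ?thesis using b K_nonpos[OF False] by (simp add: M_def divide_le_0_iff)
  qed
  then have log_M: "coeff (sqlog (n - 1) (1 - M)) S \<le> 0" for S
    by (rule coeff_sqlog_one_minus_nonpos)
  have M1: "1 - M \<in> sqfree_alg (n - 1)" and M0: "coeff (1 - M) {} = 1"
    using sqfree_alg_diff_var_last[OF l] b K0
    by (auto simp: M_def K_def sqfree_alg_def split: if_splits)
  have marginal: "marginal n f = (1 / (1 + b)) *\<^sub>R (A + diff_var n f)"
    by (simp add: marginal_def subst_last_one_eq[OF assms(1) f] A_def b_def)
  also have "\<dots> = A * (1 - M)"
    by (simp add: M_def distrib_left flip: AK)
  finally have marginal_mult: "marginal n f = A * (1 - M)" .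
  show ?thesis
    unfolding LC_def
  proof (intro CollectI conjI allI impI)
    show "marginal n f \<in> sqfree_alg (n - 1)"
      unfolding marginal_mult by (rule sqfree_alg_mult[OF A M1])
    show "coeff (marginal n f) {} = 1"
      using A0 M0 by (simp add: marginal_mult coeff_mult_empty)
    fix S assume S: "S \<subseteq> {1..n - 1}"
    then have S': "S \<subseteq> {1..n}" "insert n S \<subseteq> {1..n}" "n \<notin> S"
      using assms(1) unfolding atLeastAtMost_Diff_last[symmetric] by auto
    show "coeff (marginal n f) S \<ge> 0"
      using b S' f_nonneg by (simp add: marginal A_def coeff_drop_var coeff_diff_var)
    show "cumulant (n - 1) (marginal n f) S \<le> 0" if "card S \<ge> 2"
    proof -
      \<comment> \<open>Hence the cumulants of \<open>A\<close> are those of \<open>f\<close> on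
        sets avoiding \<open>n\<close>.\<close>
      have "sqlog (n - 1) A = drop_var n l"
        using A A0 f f0 sqlog_mono[of "n - 1" n A] by (simp add: A_def l_def sqlog_drop_var)
      then have "coeff (sqlog (n - 1) A) S \<le> 0"
        using S' that l_nonpos by (simp add: coeff_drop_var)
      then show ?thesis
        using log_M[of S] unfolding cumulant_def marginal_mult sqlog_mult[OF A A0 M1 M0] by simp
    qed
  qed
qed

end
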